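(* Let $\Lambda\subset\mathbb{N}_0^d$ be an arbitrary finite index set. The tent-transformed lattice rule $Q_n$ of a rank-1 lattice rule $Q_n^*$ with $n$ points and generating vector $\boldsymbol{z}\in\mathbb{Z}^d$ reconstructs exactly the cosine coefficients of all cosine space functions $f\in\mathcal{F}^{\cos}_\Lambda$ solely supported on $\Lambda$, by $$\widehat f_{\boldsymbol{k}}=\widehat f^{\,a}_{\boldsymbol{k}}:=Q_n(f\,\phi_{\boldsymbol{k}})=Q_n^*((f\,\phi_{\boldsymbol{k}})\circ\varphi_{\rm tent})\qquad\text{for all }\boldsymbol{k}\in\Lambda,$$ if and only if $$\boldsymbol{h}\cdot\boldsymbol{z}\not\equiv0\pmod n\qquad\text{for all }\boldsymbol{h}\in(\mathcal{M}(\Lambda)\oplus\mathcal{M}(\Lambda))\setminus\{\boldsymbol{0}\}.$$ Such a generating vector $\boldsymbol{z}$ can be constructed component-by-component if $n$ is a prime satisfying $$n>\max\Big\{\frac{\#(\mathcal{M}(\Lambda)\oplus\mathcal{M}(\Lambda))+1}{2},\ 2\max(\Lambda)\Big\}.$$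
   Context: Cosine basis: $\phi_{\boldsymbol{k}}(\boldsymbol{x})=\sqrt2^{\,|\boldsymbol{k}|_0}\prod_{j=1}^d\cos(\pi k_jx_j)$ on $[0,1]^d$, $\boldsymbol{k}\in\mathbb{N}_0^d$, with $|\boldsymbol{k}|_0$ the number of nonzero components. $\mathcal{F}^{\cos}_\Lambda$ is the set of real-valued functions $f=\sum_{\boldsymbol{k}\in\Lambda}\widehat f_{\boldsymbol{k}}\,\phi_{\boldsymbol{k}}$ on $[0,1]^d$; the cosine coefficients are $\widehat f_{\boldsymbol{k}}=\int_{[0,1]^d}f\,\phi_{\boldsymbol{k}}\,d\boldsymbol{x}$. The rank-1 lattice rule is $Q_n^*(g)=\frac1n\sum_{i=0}^{n-1}g\big(\frac{i\boldsymbol{z}\bmod n}{n}\big)$ (mod applied componentwise), and the tent-transformed rule is $Q_n(f)=Q_n^*(f\circ\varphi_{\rm tent})$, where $\varphi_{\rm tent}(x)=1-|2x-1|$ is applied componentwise. $\mathcal{M}(\Lambda)=\{(\sigma_1k_1,\ldots,\sigma_dk_d):\boldsymbol{k}\in\Lambda,\boldsymbol{\sigma}\in\{\pm1\}^d\}$; $A\oplus B=\{\boldsymbol{a}+\boldsymbol{b}:\boldsymbol{a}\in A,\boldsymbol{b}\in B\}$; $\max(\Lambda)=\max_{\boldsymbol{k}\in\Lambda}\max_j|k_j|$; $\#$ is cardinality. "Constructed component-by-component": for an index set $\mathcal{A}\subset\mathbb{Z}^d$ (here $\mathcal{A}=\mathcal{M}(\Lambda)\oplus\mathcal{M}(\Lambda)$)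 and its projections $\mathcal{A}_s$, $s=1,\ldots,d$, given either by $\mathcal{A}_s=\{\boldsymbol{h}\in\mathbb{Z}^s:(\boldsymbol{h},\boldsymbol{0})\in\mathcal{A}\}$ or by $\mathcal{A}_s=\{\boldsymbol{h}\in\mathbb{Z}^s:(\boldsymbol{h},\boldsymbol{h}_\perp)\in\mathcal{A}\text{ for some }\boldsymbol{h}_\perp\}$, the components $z_1,\ldots,z_d\in\{1,\ldots,n-1\}$ can be chosen one at a time: whenever $z_1,\ldots,z_{s-1}$ satisfy $\boldsymbol{h}\cdot(z_1,\ldots,z_{s-1})\not\equiv0\pmod n$ for all $\boldsymbol{h}\in\mathcal{A}_{s-1}\setminus\{\boldsymbol{0}\}$ (no condition if $s=1$), there exists $z_s\in\{1,\ldots,n-1\}$ with $\boldsymbol{h}\cdot(z_1,\ldots,z_s)\not\equiv0\pmod n$ for all $\boldsymbol{h}\in\mathcal{A}_s\setminus\{\boldsymbol{0}\}$. Since $\mathcal{A}_d=\mathcal{A}$, the resulting $\boldsymbol{z}$ satisfies the required condition. *)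

theory Defs
  imports "HOL-Analysis.Analysis" "HOL-Number_Theory.Cong" "HOL-Computational_Algebra.Primes"
begin

text \<open>
  Since the dimension varies within the statement, a vector with \<open>s\<close> components is an
  extensional function on \<open>{1..s}\<close>, so that \<open>\<int>\<^sup>s\<close> is \<^term>\<open>{1..s} \<rightarrow>\<^sub>E (UNIV :: int set)\<close>
  and likewise for natural-number and real vectors.
\<close>

definition zero_vector :: "nat \<Rightarrow> nat \<Rightarrow> int" where
  "zero_vector s = (\<lambda>j\<in>{1..s}. 0)"

definition dot :: "nat \<Rightarrow> (nat \<Rightarrow> int) \<Rightarrow> (nat \<Rightarrow> int) \<Rightarrow> int" where
  "dot s h z = (\<Sum>j=1..s. h j * z j)"

definition unit_cube :: "nat \<Rightarrow> (nat \<Rightarrow> real) set" where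
  "unit_cube d = {1..d} \<rightarrow>\<^sub>E {0..1}"

definition cos_basis :: "nat \<Rightarrow> (nat \<Rightarrow> nat) \<Rightarrow> (nat \<Rightarrow> real) \<Rightarrow> real" where
  "cos_basis d k x =
     sqrt 2 ^ card {j \<in> {1..d}. k j \<noteq> 0} * (\<Prod>j=1..d. cos (pi * real (k j) * x j))"

text \<open>Only the values on the unit cube matter; those elsewhere are unconstrained.\<close>

definition cosine_space :: "nat \<Rightarrow> (nat \<Rightarrow> nat) set \<Rightarrow> ((nat \<Rightarrow> real) \<Rightarrow> real) set" where
  "cosine_space d \<Lambda> =
     {f. \<exists>c :: (nat \<Rightarrow> nat) \<Rightarrow> real. \<forall>x\<in>unit_cube d. f x = (\<Sum>k\<in>\<Lambda>. c k * cos_basis d k x)}"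

definition cosine_coeff :: "nat \<Rightarrow> ((nat \<Rightarrow> real) \<Rightarrow> real) \<Rightarrow> (nat \<Rightarrow> nat) \<Rightarrow> real" where
  "cosine_coeff d f k =
     (LINT x : unit_cube d | (\<Pi>\<^sub>M j\<in>{1..d}. lborel). f x * cos_basis d k x)"

definition lattice_rule ::
    "nat \<Rightarrow> nat \<Rightarrow> (nat \<Rightarrow> int) \<Rightarrow> ((nat \<Rightarrow> real) \<Rightarrow> real) \<Rightarrow> real" where
  "lattice_rule d n z g =
     (1 / real n) * (\<Sum>i<n. g (\<lambda>j\<in>{1..d}. real_of_int ((int i * z j) mod int n) / real n))"

definition tent :: "nat \<Rightarrow> (nat \<Rightarrow> real) \<Rightarrow> (nat \<Rightarrow> real)" where
  "tent d x = (\<lambda>j\<in>{1..d}. 1 - \<bar>2 * x j - 1\<bar>)"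

definition tent_lattice_rule ::
    "nat \<Rightarrow> nat \<Rightarrow> (nat \<Rightarrow> int) \<Rightarrow> ((nat \<Rightarrow> real) \<Rightarrow> real) \<Rightarrow> real" where
  "tent_lattice_rule d n z f = lattice_rule d n z (f \<circ> tent d)"

definition mirror :: "nat \<Rightarrow> (nat \<Rightarrow> nat) set \<Rightarrow> (nat \<Rightarrow> int) set" where
  "mirror d \<Lambda> = {\<lambda>j\<in>{1..d}. \<sigma> j * int (k j) | \<sigma> k. \<sigma> \<in> {1..d} \<rightarrow>\<^sub>E {-1, 1} \<and> k \<in> \<Lambda>}"

definition sumset :: "nat \<Rightarrow> (nat \<Rightarrow> int) set \<Rightarrow> (nat \<Rightarrow> int) set \<Rightarrow> (nat \<Rightarrow> int) set" where
  "sumset d A B = {\<lambda>j\<in>{1..d}. a j + b j | a b. a \<in> A \<and> b \<in> B}"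

text \<open>The inserted 0 only matters for empty \<open>\<Lambda>\<close>, where the maximum is taken to be 0.\<close>

definition max_index :: "nat \<Rightarrow> (nat \<Rightarrow> nat) set \<Rightarrow> nat" where
  "max_index d \<Lambda> = Max (insert 0 {k j | k j. k \<in> \<Lambda> \<and> j \<in> {1..d}})"

definition admissible :: "nat \<Rightarrow> nat \<Rightarrow> (nat \<Rightarrow> int) set \<Rightarrow> (nat \<Rightarrow> int) \<Rightarrow> bool" where
  "admissible s n H z \<longleftrightarrow> (\<forall>h \<in> H - {zero_vector s}. \<not> [dot s h z = 0] (mod int n))"

text \<open>The vectors \<open>h \<in> \<int>\<^sup>s\<close> with \<open>(h, 0) \<in> A\<close>.\<close>

definition zero_section :: "nat \<Rightarrow> (nat \<Rightarrow> int) set \<Rightarrow> nat \<Rightarrow> (nat \<Rightarrow> int) set" where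
  "zero_section d A s =
     {h \<in> {1..s} \<rightarrow>\<^sub>E UNIV. (\<lambda>j\<in>{1..d}. if j \<le> s then h j else 0) \<in> A}"

text \<open>The vectors \<open>h \<in> \<int>\<^sup>s\<close> with \<open>(h, h') \<in> A\<close> for some \<open>h'\<close>.\<close>

definition projection :: "nat \<Rightarrow> (nat \<Rightarrow> int) set \<Rightarrow> nat \<Rightarrow> (nat \<Rightarrow> int) set" where
  "projection d A s =
     {h \<in> {1..s} \<rightarrow>\<^sub>E UNIV.
        \<exists>h' \<in> {s+1..d} \<rightarrow>\<^sub>E UNIV. (\<lambda>j\<in>{1..d}. if j \<le> s then h j else h' j) \<in> A}"

text \<open>
  Any admissible choice of the first \<open>s - 1\<close> components in \<open>{1..n-1}\<close> extends to the \<open>s\<close>-th one.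
  For \<open>s = 1\<close> the hypothesis on the earlier components is void, since \<open>\<int>\<^sup>0\<close> consists of the
  zero vector only. The equation \<open>P d = A\<close> says that completing all \<open>d\<close> steps gives a vector
  admissible for \<open>A\<close> itself.
\<close>

definition cbc_constructible ::
    "nat \<Rightarrow> nat \<Rightarrow> (nat \<Rightarrow> int) set \<Rightarrow> (nat \<Rightarrow> (nat \<Rightarrow> int) set) \<Rightarrow> bool" where
  "cbc_constructible d n A P \<longleftrightarrow>
     P d = A \<and>
     (\<forall>s\<in>{1..d}. \<forall>z \<in> {1..s-1} \<rightarrow>\<^sub>E {1..int n - 1}.
        admissible (s - 1) n (P (s - 1)) z \<longrightarrow>
        (\<exists>w\<in>{1..int n - 1}. admissible s n (P s) (z(s := w))))"

end

theory Submission
  imports Defs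
begin

text \<open>
  The tent transform turns \<open>cos (\<pi> k x)\<close> into \<open>cos (2 \<pi> k x)\<close> on the unit interval. Hence the
  product of two tent-transformed basis functions with indices \<open>l\<close> and \<open>k\<close> is a positive multiple of
  the sum of the characters \<open>x \<mapsto> exp (2 \<pi> \<i> h \<cdot> x)\<close>, where \<open>h = \<sigma> l + \<rho> k\<close> runs over all \<open>4\<^sup>d\<close> pairs
  \<open>(\<sigma>, \<rho>)\<close> of sign vectors. The lattice rule maps such a character to 1 if \<open>n\<close> divides \<open>h \<cdot> z\<close> and to 0
  otherwise (\<open>sum_roots_of_unity\<close>). The integral of the original product over the unit cube has the
  same form, with the condition \<open>h = 0\<close> in place of divisibility. Both the exact inner product and
  its approximation thus count sign pairs with the same weight:
  \<open>has_bochner_integral_cos_basis_mult\<close> counts those with \<open>h = 0\<close>, and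
  \<open>tent_lattice_rule_cos_basis_mult\<close> those with \<open>h \<cdot> z \<equiv> 0 (mod n)\<close>. The second set contains the
  first, so the counts agree exactly if the sets do. No cancellation between different \<open>h\<close> can hide
  an aliasing error, which makes the criterion necessary and not just sufficient. The vectors \<open>h\<close>
  that occur for \<open>k, l \<in> \<Lambda>\<close> are precisely the elements of \<open>\<M>(\<Lambda>) \<oplus> \<M>(\<Lambda>)\<close>
  (\<open>sumset_mirror_eq\<close>), and linearity extends the result from basis functions to the cosine space.

  For the component-by-component construction, fix the first components of \<open>z\<close> and let \<open>w\<close> be a
  candidate for the next one. A vector \<open>h\<close> whose new component \<open>c\<close> vanishes is covered by the
  previous step. If \<open>c \<noteq> 0\<close>, then \<open>\<bar>c\<bar> \<le> 2 max(\<Lambda>) < n\<close> makes \<open>c\<close> invertible modulo the prime \<open>n\<close>, so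
  \<open>h\<close> rules out at most one residue \<open>w\<close>, and \<open>-h\<close> rules out the same one. A nonempty index set
  is symmetric and contains 0, so its \<open>m\<close> elements rule out at most \<open>(m - 1) / 2 < n - 1\<close> residues, which
  leaves one of the \<open>n - 1\<close> candidates (\<open>card_positive_component\<close>, \<open>admissible_extension\<close>).
\<close>

section \<open>Sign patterns\<close>

definition sign_pairs :: "nat \<Rightarrow> (nat \<Rightarrow> int \<times> int) set" where
  "sign_pairs d = {1..d} \<rightarrow>\<^sub>E {-1, 1} \<times> {-1, 1}"

definition signed_sum ::
    "nat \<Rightarrow> (nat \<Rightarrow> nat) \<Rightarrow> (nat \<Rightarrow> nat) \<Rightarrow> (nat \<Rightarrow> int \<times> int) \<Rightarrow> nat \<Rightarrow> int" where
  "signed_sum d k l \<tau> = (\<lambda>j\<in>{1..d}. fst (\<tau> j) * int (k j) + snd (\<tau> j) * int (l j))"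

lemma finite_sign_pairs: "finite (sign_pairs d)"
  unfolding sign_pairs_def by (intro finite_PiE) auto

text \<open>
  This identifies the vectors of the reconstruction criterion with the frequencies that occur in
  products of two tent-transformed basis functions.
\<close>

lemma sumset_mirror_eq:
  "sumset d (mirror d \<Lambda>) (mirror d \<Lambda>) =
     {signed_sum d k l \<tau> | k l \<tau>. k \<in> \<Lambda> \<and> l \<in> \<Lambda> \<and> \<tau> \<in> sign_pairs d}" (is "?L = ?R")
proof (intro equalityI subsetI)
  fix h assume "h \<in> ?L"
  then obtain \<sigma> k \<rho> l where kl: "k \<in> \<Lambda>" "l \<in> \<Lambda>"
    and sg: "\<sigma> \<in> {1..d} \<rightarrow>\<^sub>E {-1, 1::int}" "\<rho> \<in> {1..d} \<rightarrow>\<^sub>E {-1, 1::int}"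
    and h: "h = (\<lambda>j\<in>{1..d}. (\<lambda>j\<in>{1..d}. \<sigma> j * int (k j)) j + (\<lambda>j\<in>{1..d}. \<rho> j * int (l j)) j)"
    unfolding sumset_def mirror_def by blast
  have "h = signed_sum d k l (\<lambda>j\<in>{1..d}. (\<sigma> j, \<rho> j))"
    by (auto simp: h signed_sum_def)
  moreover have "(\<lambda>j\<in>{1..d}. (\<sigma> j, \<rho> j)) \<in> sign_pairs d"
    using sg by (auto simp: sign_pairs_def PiE_iff)
  ultimately show "h \<in> ?R" using kl by blast
next
  fix h assume "h \<in> ?R"
  then obtain k l \<tau> where kl: "k \<in> \<Lambda>" "l \<in> \<Lambda>" and \<tau>: "\<tau> \<in> sign_pairs d"
    and h: "h = signed_sum d k l \<tau>" by blast
  have "(\<lambda>j\<in>{1..d}. (\<lambda>j\<in>{1..d}. fst (\<tau> j)) j * int (k j)) \<in> mirror d \<Lambda>"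
    unfolding mirror_def using \<tau> kl
    by (intro CollectI exI[of _ "\<lambda>j\<in>{1..d}. fst (\<tau> j)"] exI[of _ k]) (force simp: sign_pairs_def PiE_iff)
  moreover have "(\<lambda>j\<in>{1..d}. (\<lambda>j\<in>{1..d}. snd (\<tau> j)) j * int (l j)) \<in> mirror d \<Lambda>"
    unfolding mirror_def using \<tau> kl
    by (intro CollectI exI[of _ "\<lambda>j\<in>{1..d}. snd (\<tau> j)"] exI[of _ l]) (force simp: sign_pairs_def PiE_iff)
  moreover have "h = (\<lambda>j\<in>{1..d}. (\<lambda>j\<in>{1..d}. (\<lambda>j\<in>{1..d}. fst (\<tau> j)) j * int (k j)) j
      + (\<lambda>j\<in>{1..d}. (\<lambda>j\<in>{1..d}. snd (\<tau> j)) j * int (l j)) j)"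
    by (auto simp: h signed_sum_def)
  ultimately show "h \<in> ?L"
    unfolding sumset_def by blast
qed

section \<open>Products of cosine basis functions\<close>

text \<open>
  The common coefficient of the characters in a product of two tent-transformed basis functions.
\<close>

definition pair_weight :: "nat \<Rightarrow> (nat \<Rightarrow> nat) \<Rightarrow> (nat \<Rightarrow> nat) \<Rightarrow> real" where
  "pair_weight d k l =
     sqrt 2 ^ (card {j \<in> {1..d}. k j \<noteq> 0} + card {j \<in> {1..d}. l j \<noteq> 0}) / 4 ^ d"

lemma pair_weight_pos: "pair_weight d k l > 0"
  by (simp add: pair_weight_def)

lemma cos_basis_mult:
  "cos_basis d k x * cos_basis d l x =
     pair_weight d k l * (\<Prod>j=1..d. 4 * (cos (pi * k j * x j) * cos (pi * l j * x j)))"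
  by (simp add: cos_basis_def pair_weight_def prod.distrib power_add)

text \<open>
  The product-to-sum formula is used in two versions: the real one gives the integrals in one
  variable, and the complex one turns products over the coordinates into characters of the whole
  vector. The imaginary parts cancel because the signs occur in opposite pairs.
\<close>

lemma four_cos_mult_cos:
  "4 * (cos a * cos b) =
     (\<Sum>p\<in>{-1, 1::int} \<times> {-1, 1::int}. cos (real_of_int (fst p) * a + real_of_int (snd p) * b))"
  by (simp add: sum.cartesian_product[symmetric] cos_add cos_diff)
  
lemma four_cos_mult_cos_cis:
  "complex_of_real (4 * (cos a * cos b)) =
     (\<Sum>p\<in>{-1, 1::int} \<times> {-1, 1::int}. cis (real_of_int (fst p) * a + real_of_int (snd p) * b))"
  by (simp add: sum.cartesian_product[symmetric] complex_eq_iff cos_add sin_add cos_diff sin_diff algebra_simps)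

text \<open>
  The tent is \<open>2 x\<close> on the left half of the interval and \<open>2 - 2 x\<close> on the right half; there the
  cosine is unchanged because it is even and \<open>2 \<pi> k\<close> is a period.
\<close>

lemma cos_pi_tent:
  assumes "0 \<le> x" "x \<le> 1"
  shows "cos (pi * real k * (1 - \<bar>2 * x - 1\<bar>)) = cos (2 * pi * (real k * x))"
proof (cases "x \<le> 1 / 2")
  case True
  then show ?thesis by (simp add: algebra_simps)
next
  case False
  then have "pi * real k * (1 - \<bar>2 * x - 1\<bar>) = 2 * pi * real k - 2 * pi * (real k * x)"
    by (simp add: algebra_simps)
  moreover have "cos (2 * pi * real k) = 1" "sin (2 * pi * real k) = 0"
    using cos_int_2pin[of k] sin_int_2pin[of k] by simp_all
  ultimately show ?thesis by (simp add: cos_diff)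
qed

lemma cis_sum: "cis (\<Sum>j\<in>J. f j) = (\<Prod>j\<in>J. cis (f j))"
  by (induction J rule: infinite_finite_induct) (simp_all flip: cis_mult)

lemma tent_in_unit_cube:
  assumes "x \<in> unit_cube d"
  shows "tent d x \<in> unit_cube d"
proof -
  have "0 \<le> x j \<and> x j \<le> 1" if "j \<in> {1..d}" for j
    using assms PiE_mem[OF assms[unfolded unit_cube_def] that] by simp
  then show ?thesis
    by (fastforce simp: tent_def unit_cube_def abs_le_iff)
qed

text \<open>
  Multiplying out the coordinatewise sums over two signs gives one sum over all sign pairs, each of
  which contributes a character.
\<close>

lemma cos_basis_mult_tent:
  assumes "x \<in> unit_cube d"
  shows "complex_of_real (cos_basis d k (tent d x) * cos_basis d l (tent d x)) =
    complex_of_real (pair_weight d k l) *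
      (\<Sum>\<tau>\<in>sign_pairs d. cis (2 * pi * (\<Sum>j=1..d. real_of_int (signed_sum d k l \<tau> j) * x j)))"
proof -
  have "4 * (cos (pi * k j * tent d x j) * cos (pi * l j * tent d x j)) =
      4 * (cos (2 * pi * (k j * x j)) * cos (2 * pi * (l j * x j)))" if "j \<in> {1..d}" for j
    using cos_pi_tent[of "x j"] PiE_mem[OF assms[unfolded unit_cube_def] that] that
    by (simp add: tent_def)
  then have "complex_of_real (\<Prod>j=1..d. 4 * (cos (pi * k j * tent d x j) * cos (pi * l j * tent d x j))) =
      (\<Prod>j=1..d. complex_of_real (4 * (cos (2 * pi * (k j * x j)) * cos (2 * pi * (l j * x j)))))"
    unfolding of_real_prod by (intro prod.cong refl) metis
  also have "\<dots> = (\<Sum>\<tau>\<in>sign_pairs d. \<Prod>j=1..d.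
      cis (real_of_int (fst (\<tau> j)) * (2 * pi * (k j * x j)) + real_of_int (snd (\<tau> j)) * (2 * pi * (l j * x j))))"
    unfolding four_cos_mult_cos_cis sign_pairs_def by (rule prod_sum_PiE) auto
  also have "\<dots> = (\<Sum>\<tau>\<in>sign_pairs d. cis (2 * pi * (\<Sum>j=1..d. real_of_int (signed_sum d k l \<tau> j) * x j)))"
    unfolding sum_distrib_left cis_sum signed_sum_def
    by (intro sum.cong prod.cong refl arg_cong[of _ _ cis]) (simp add: algebra_simps)
  finally show ?thesis
    by (simp add: cos_basis_mult)
qed

section \<open>The lattice rule on products of basis functions\<close>

lemma cis_2pi_div_eq_1_iff:
  assumes "n \<ge> 1"
  shows "cis (2 * pi * (real_of_int m / real n)) = 1 \<longleftrightarrow> int n dvd m"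
proof
  assume "cis (2 * pi * (real_of_int m / real n)) = 1"
  then have "exp (\<i> * complex_of_real (2 * pi * (real_of_int m / real n))) = 1"
    by (simp only: cis_conv_exp)
  then obtain q :: int where "2 * pi * (real_of_int m / real n) = of_int (2 * q) * pi"
    unfolding exp_eq_1 by auto
  then have "real_of_int m = real_of_int (int n * q)"
    using assms by (simp add: field_simps)
  then have "m = int n * q" by (simp only: of_int_eq_iff)
  then show "int n dvd m" by simp
next
  assume "int n dvd m"
  then obtain q where "m = int n * q" ..
  then show "cis (2 * pi * (real_of_int m / real n)) = 1"
    using assms by simp
qed

lemma sum_roots_of_unity:
  assumes "n \<ge> 1"
  shows "(\<Sum>i<n. cis (2 * pi * (real_of_int m / real n)) ^ i) = of_nat n * of_bool (int n dvd m)"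
proof -
  have "cis (2 * pi * (real_of_int m / real n)) ^ n = 1"
  proof -
    have "real n * (2 * pi * (real_of_int m / real n)) = 2 * pi * real_of_int m"
      using assms by simp
    then show ?thesis
      unfolding Complex.DeMoivre by (simp only: cis_multiple_2pi Ints_of_int)
  qed
  then show ?thesis
    using cis_2pi_div_eq_1_iff[OF assms, of m] by (auto simp: sum_gp_strict simp del: times_divide_eq_right)
qed

definition lattice_point :: "nat \<Rightarrow> nat \<Rightarrow> (nat \<Rightarrow> int) \<Rightarrow> nat \<Rightarrow> nat \<Rightarrow> real" where
  "lattice_point d n z i = (\<lambda>j\<in>{1..d}. real_of_int ((int i * z j) mod int n) / real n)"

lemma lattice_point_in_unit_cube:
  assumes "n \<ge> 1"
  shows "lattice_point d n z i \<in> unit_cube d"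
proof -
  have "real_of_int ((int i * z j) mod int n) \<le> real n" for j
    using assms by (metis of_int_le_iff of_int_of_nat_eq pos_mod_bound order_less_imp_le of_nat_0_less_iff less_le_trans zero_less_one)
  then show ?thesis
    using assms by (auto simp: lattice_point_def unit_cube_def divide_le_eq)
qed

text \<open>
  Reducing \<open>i z\<close> modulo \<open>n\<close> changes the phase by a multiple of \<open>2 \<pi>\<close>, so a character restricted to
  the lattice points is a geometric progression in the point number \<open>i\<close>.
\<close>

lemma cis_lattice_point:
  assumes "n \<ge> 1"
  shows "cis (2 * pi * (\<Sum>j=1..d. real_of_int (h j) * lattice_point d n z i j)) =
    cis (2 * pi * (real_of_int (dot d h z) / real n)) ^ i"
proof -
  have *: "real_of_int a * (real_of_int (b mod int n) / real n) =
      real_of_int (a * b) / real n - real_of_int (a * (b div int n))" for a b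
  proof -
    have "real_of_int b = real_of_int (int n * (b div int n) + b mod int n)" by simp
    then have "real_of_int (b mod int n) = real_of_int b - real n * real_of_int (b div int n)"
      by (simp only: of_int_add of_int_mult of_int_of_nat_eq)
    then have "real_of_int (b mod int n) / real n =
        real_of_int b / real n - real_of_int (b div int n)"
      using assms by (simp add: diff_divide_distrib)
    then show ?thesis by (simp add: right_diff_distrib)
  qed
  have "(\<Sum>j=1..d. real_of_int (h j) * lattice_point d n z i j) =
      (\<Sum>j=1..d. real_of_int (h j * (int i * z j)) / real n
         - real_of_int (h j * ((int i * z j) div int n)))"
    unfolding *[symmetric] by (intro sum.cong) (auto simp: lattice_point_def)
  also have "\<dots> = real i * (real_of_int (dot d h z) / real n)
      - real_of_int (\<Sum>j=1..d. h j * ((int i * z j) div int n))"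
    by (simp add: sum_subtractf dot_def sum_distrib_left sum_divide_distrib algebra_simps)
  finally have "2 * pi * (\<Sum>j=1..d. real_of_int (h j) * lattice_point d n z i j) =
     real i * (2 * pi * (real_of_int (dot d h z) / real n))
      - 2 * pi * real_of_int (\<Sum>j=1..d. h j * ((int i * z j) div int n))"
    by (simp only: right_diff_distrib mult.left_commute mult.assoc)
  then show ?thesis
    by (simp only: Complex.DeMoivre cis_divide[symmetric] cis_multiple_2pi Ints_of_int div_by_1)
qed

lemma tent_lattice_rule_eq:
  "tent_lattice_rule d n z f = (\<Sum>i<n. f (tent d (lattice_point d n z i))) / real n"
  by (simp add: tent_lattice_rule_def lattice_rule_def lattice_point_def)

lemma tent_lattice_rule_cos_basis_mult:
  assumes "n \<ge> 1"
  shows "tent_lattice_rule d n z (\<lambda>x. cos_basis d l x * cos_basis d k x) =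
    pair_weight d l k * real (card {\<tau> \<in> sign_pairs d. int n dvd dot d (signed_sum d l k \<tau>) z})"
proof -
  have "complex_of_real (\<Sum>i<n. cos_basis d l (tent d (lattice_point d n z i)) *
        cos_basis d k (tent d (lattice_point d n z i))) =
      (\<Sum>i<n. complex_of_real (pair_weight d l k) * (\<Sum>\<tau>\<in>sign_pairs d.
         cis (2 * pi * (real_of_int (dot d (signed_sum d l k \<tau>) z) / real n)) ^ i))"
    unfolding of_real_sum
    by (intro sum.cong refl)
      (simp only: cos_basis_mult_tent[OF lattice_point_in_unit_cube[OF assms]] cis_lattice_point[OF assms])
  also have "\<dots> = complex_of_real (pair_weight d l k) * (\<Sum>\<tau>\<in>sign_pairs d. \<Sum>i<n. 
         cis (2 * pi * (real_of_int (dot d (signed_sum d l k \<tau>) z) / real n)) ^ i)"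
    unfolding sum_distrib_left[symmetric] by (subst sum.swap) simp
  also have "\<dots> = complex_of_real (pair_weight d l k) * (of_nat n * of_nat
      (card {\<tau> \<in> sign_pairs d. int n dvd dot d (signed_sum d l k \<tau>) z}))"
    unfolding sum_roots_of_unity[OF assms]
    by (simp add: finite_sign_pairs Int_def flip: sum_distrib_left)
  also have "\<dots> = complex_of_real (pair_weight d l k * (real n * real
      (card {\<tau> \<in> sign_pairs d. int n dvd dot d (signed_sum d l k \<tau>) z})))"
    by simp
  finally show ?thesis
    using assms unfolding tent_lattice_rule_eq of_real_eq_iff by simp
qed

section \<open>Inner products of basis functions\<close>

lemma has_bochner_integral_cos_pi:
  "has_bochner_integral lborel (\<lambda>x. cos (pi * real_of_int m * x) * indicator {0..1} x)
     (of_bool (m = 0))"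
proof (cases "m = 0")
  case True
  have "has_bochner_integral lborel (\<lambda>x::real. (1::real) * indicator {0..1} x) (1 - 0)"
    by (rule has_bochner_integral_FTC_Icc_real[where F = "\<lambda>x. x"]) (auto intro!: derivative_eq_intros)
  then show ?thesis using True by simp
next
  case False
  have "has_bochner_integral lborel (\<lambda>x. cos (pi * real_of_int m * x) * indicator {0..1} x)
      (sin (pi * real_of_int m * 1) / (pi * real_of_int m) - sin (pi * real_of_int m * 0) / (pi * real_of_int m))"
    using False
    by (intro has_bochner_integral_FTC_Icc_real[where F = "\<lambda>x. sin (pi * real_of_int m * x) / (pi * real_of_int m)"])
      (auto intro!: derivative_eq_intros continuous_intros)
  then show ?thesis using False by (simp add: sin_npi_int)
qed

abbreviation cube_measure :: "nat \<Rightarrow> (nat \<Rightarrow> real) measure" where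
  "cube_measure d \<equiv> \<Pi>\<^sub>M j\<in>{1..d}. lborel"

lemma has_bochner_integral_four_cos_mult_cos:
  "has_bochner_integral lborel
     (\<lambda>t. 4 * (cos (pi * real k * t) * cos (pi * real l * t)) * indicator {0..1} t)
     (\<Sum>p\<in>{-1, 1} \<times> {-1, 1}. of_bool (fst p * int k + snd p * int l = 0))"
proof -
  have "4 * (cos (pi * real k * t) * cos (pi * real l * t)) * indicator {0..1} t =
      (\<Sum>p\<in>{-1, 1} \<times> {-1, 1}. cos (pi * real_of_int (fst p * int k + snd p * int l) * t) * indicator {0..1} t)"
    for t
    unfolding four_cos_mult_cos sum_distrib_right
    by (intro sum.cong refl) (simp add: algebra_simps)
  then show ?thesis
    by (simp only:) (intro has_bochner_integral_sum has_bochner_integral_cos_pi)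
qed

lemma indicator_unit_cube:
  assumes "x \<in> space (cube_measure d)"
  shows "indicat_real (unit_cube d) x = (\<Prod>j=1..d. indicator {0..1} (x j))"
proof (cases "x \<in> unit_cube d")
  case True
  then have "indicat_real {0..1} (x j) = 1" if "j \<in> {1..d}" for j
    using PiE_mem[OF True[unfolded unit_cube_def] that] by simp
  then show ?thesis
    using True by simp
next
  case False
  then obtain j where "j \<in> {1..d}" "x j \<notin> {0..1}"
    using assms by (auto simp: unit_cube_def space_PiM PiE_iff)
  then have "(\<Prod>j=1..d. indicat_real {0..1} (x j)) = 0"
    by (intro prod_zero) (auto simp: indicator_def)
  then show ?thesis
    using False by simp
qed

text \<open>
  By Fubini the integral is a product of one-dimensional ones, each of which counts the sign pairs
  that make one component of \<open>h\<close> vanish. Multiplying out as in \<open>cos_basis_mult_tent\<close> then counts the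
  sign pairs for which all components vanish. Orthonormality of the basis is implicit in this count.
\<close>

lemma has_bochner_integral_cos_basis_mult:
  "has_bochner_integral (cube_measure d)
     (\<lambda>x. indicator (unit_cube d) x * (cos_basis d l x * cos_basis d k x))
     (pair_weight d l k * real (card {\<tau> \<in> sign_pairs d. signed_sum d l k \<tau> = zero_vector d}))"
proof -
  interpret product_sigma_finite "\<lambda>_::nat. lborel :: real measure"
    by standard
  let ?g = "\<lambda>j t. 4 * (cos (pi * real (l j) * t) * cos (pi * real (k j) * t)) * indicator {0..1} t"
  let ?I = "\<lambda>j. \<Sum>p\<in>{-1, 1} \<times> {-1, 1}. of_bool (fst p * int (l j) + snd p * int (k j) = 0) :: real"
  note g = has_bochner_integral_four_cos_mult_cos
  have "has_bochner_integral (cube_measure d) (\<lambda>x. \<Prod>j=1..d. ?g j (x j)) (\<Prod>j=1..d. ?I j)"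
    unfolding has_bochner_integral_iff
    using product_integrable_prod[of "{1..d}" ?g] product_integral_prod[of "{1..d}" ?g]
    by (simp only: g[unfolded has_bochner_integral_iff] finite_atLeastAtMost)
  then have "has_bochner_integral (cube_measure d) (\<lambda>x. pair_weight d l k * (\<Prod>j=1..d. ?g j (x j)))
      (pair_weight d l k * (\<Prod>j=1..d. ?I j))"
    by (rule has_bochner_integral_mult_right)
  also have "?this \<longleftrightarrow> has_bochner_integral (cube_measure d)
     (\<lambda>x. indicator (unit_cube d) x * (cos_basis d l x * cos_basis d k x))
      (pair_weight d l k * (\<Prod>j=1..d. ?I j))"
    by (intro has_bochner_integral_cong refl)
      (simp add: cos_basis_mult indicator_unit_cube prod.distrib del: prod_constant)
  also have "(\<Prod>j=1..d. ?I j) =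
      (\<Sum>\<tau>\<in>sign_pairs d. \<Prod>j=1..d. of_bool (fst (\<tau> j) * int (l j) + snd (\<tau> j) * int (k j) = 0))"
    unfolding sign_pairs_def by (rule prod_sum_PiE) auto
  also have "\<dots> = (\<Sum>\<tau>\<in>sign_pairs d. of_bool (signed_sum d l k \<tau> = zero_vector d))"
  proof (intro sum.cong refl)
    fix \<tau> :: "nat \<Rightarrow> int \<times> int"
    have "(signed_sum d l k \<tau> = zero_vector d) \<longleftrightarrow>
        (\<forall>j\<in>{1..d}. fst (\<tau> j) * int (l j) + snd (\<tau> j) * int (k j) = 0)"
      by (auto simp: signed_sum_def zero_vector_def fun_eq_iff restrict_def)
    then show "(\<Prod>j=1..d. of_bool (fst (\<tau> j) * int (l j) + snd (\<tau> j) * int (k j) = 0)) =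
        (of_bool (signed_sum d l k \<tau> = zero_vector d) :: real)"
      by (auto simp: of_bool_def intro!: prod_zero)
  qed
  also have "\<dots> = real (card {\<tau> \<in> sign_pairs d. signed_sum d l k \<tau> = zero_vector d})"
    by (simp add: finite_sign_pairs Int_def)
  finally show ?thesis .
qed

section \<open>Exact reconstruction\<close>

lemma cosine_coeff_expansion:
  assumes "\<forall>x\<in>unit_cube d. f x = (\<Sum>l\<in>\<Lambda>. c l * cos_basis d l x)"
  shows "cosine_coeff d f k = (\<Sum>l\<in>\<Lambda>. c l * (pair_weight d l k *
    real (card {\<tau> \<in> sign_pairs d. signed_sum d l k \<tau> = zero_vector d})))"
proof -
  have "cosine_coeff d f k = (\<integral>x. (\<Sum>l\<in>\<Lambda>. c l *
      (indicator (unit_cube d) x * (cos_basis d l x * cos_basis d k x))) \<partial>cube_measure d)"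
    unfolding cosine_coeff_def set_lebesgue_integral_def
    by (intro Bochner_Integration.integral_cong refl)
      (auto simp: assms sum_distrib_right indicator_def intro!: sum.cong)
  also have "\<dots> = (\<Sum>l\<in>\<Lambda>. c l * (pair_weight d l k *
    real (card {\<tau> \<in> sign_pairs d. signed_sum d l k \<tau> = zero_vector d})))"
    by (intro has_bochner_integral_integral_eq has_bochner_integral_sum
        has_bochner_integral_mult_right has_bochner_integral_cos_basis_mult)
  finally show ?thesis .
qed

lemma tent_lattice_rule_expansion:
  assumes "n \<ge> 1"
    and "\<forall>x\<in>unit_cube d. f x = (\<Sum>l\<in>\<Lambda>. c l * cos_basis d l x)"
  shows "tent_lattice_rule d n z (\<lambda>x. f x * cos_basis d k x) = (\<Sum>l\<in>\<Lambda>. c l * (pair_weight d l k *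
    real (card {\<tau> \<in> sign_pairs d. int n dvd dot d (signed_sum d l k \<tau>) z})))"
proof -
  have "tent_lattice_rule d n z (\<lambda>x. f x * cos_basis d k x) =
      (\<Sum>l\<in>\<Lambda>. c l * tent_lattice_rule d n z (\<lambda>x. cos_basis d l x * cos_basis d k x))"
    unfolding tent_lattice_rule_eq
      assms(2)[rule_format, OF tent_in_unit_cube[OF lattice_point_in_unit_cube[OF assms(1)]]]
    by (simp add: sum_distrib_left sum_distrib_right sum_divide_distrib sum.swap[of _ "{..<n}" \<Lambda>] mult_ac)
  then show ?thesis
    by (simp add: tent_lattice_rule_cos_basis_mult[OF assms(1)])
qed

lemma cos_basis_in_cosine_space:
  assumes "finite \<Lambda>" "k \<in> \<Lambda>"
  shows "cos_basis d k \<in> cosine_space d \<Lambda>"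
  unfolding cosine_space_def
  using assms by (auto intro!: exI[of _ "\<lambda>l. of_bool (l = k)"])

lemma dot_zero_vector: "dot d (zero_vector d) z = 0"
  by (simp add: dot_def zero_vector_def)

text \<open>
  Expansions of both sides differ only in the sets of sign pairs that are counted. If some \<open>h \<noteq> 0\<close>
  violates the condition, say \<open>h = \<sigma> l + \<rho> k\<close>, then the basis function with index \<open>l\<close> is a witness: its
  \<open>k\<close>-th coefficient is overestimated, since \<open>(\<sigma>, \<rho>)\<close> is counted by the lattice rule only.
\<close>

lemma reconstruction_iff:
  fixes d n :: nat and \<Lambda> :: "(nat \<Rightarrow> nat) set"
  assumes "n \<ge> 1" "finite \<Lambda>"
  defines "A \<equiv> sumset d (mirror d \<Lambda>) (mirror d \<Lambda>)"
  shows "(\<forall>f\<in>cosine_space d \<Lambda>. \<forall>k\<in>\<Lambda>.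
        cosine_coeff d f k = tent_lattice_rule d n z (\<lambda>x. f x * cos_basis d k x)) \<longleftrightarrow>
      admissible d n A z" (is "?exact \<longleftrightarrow> _")
proof
  assume ?exact
  show "admissible d n A z"
    unfolding admissible_def
  proof (intro ballI notI)
    fix h assume "h \<in> A - {zero_vector d}" and h0: "[dot d h z = 0] (mod int n)"
    then obtain l k \<tau> where lk: "l \<in> \<Lambda>" "k \<in> \<Lambda>" and \<tau>: "\<tau> \<in> sign_pairs d"
      and h: "h = signed_sum d l k \<tau>" "h \<noteq> zero_vector d"
      unfolding A_def sumset_mirror_eq by blast
    let ?zero = "{\<tau> \<in> sign_pairs d. signed_sum d l k \<tau> = zero_vector d}"
    let ?alias = "{\<tau> \<in> sign_pairs d. int n dvd dot d (signed_sum d l k \<tau>) z}"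
    \<comment> \<open>\<open>\<tau>\<close> itself shows that the inclusion is proper\<close>
    have "?zero \<subset> ?alias"
      using h h0 \<tau> by (auto simp: dot_zero_vector cong_0_iff)
    then have "card ?zero < card ?alias"
      by (intro psubset_card_mono) (simp_all add: finite_sign_pairs)
    moreover have "cosine_coeff d (cos_basis d l) k = pair_weight d l k * real (card ?zero)"
      using cosine_coeff_expansion[of d "cos_basis d l" "\<lambda>_. 1" "{l}"] by simp
    moreover have "tent_lattice_rule d n z (\<lambda>x. cos_basis d l x * cos_basis d k x) =
        pair_weight d l k * real (card ?alias)"
      by (rule tent_lattice_rule_cos_basis_mult[OF assms(1)])
    ultimately show False
      using \<open>?exact\<close> cos_basis_in_cosine_space[OF assms(2) lk(1), of d] lk(2) pair_weight_pos[of d l k]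
      by simp
  qed
next
  assume adm: "admissible d n A z"
  show ?exact
  proof (intro ballI)
    fix f k assume "f \<in> cosine_space d \<Lambda>" and k: "k \<in> \<Lambda>"
    then obtain c where f: "\<forall>x\<in>unit_cube d. f x = (\<Sum>l\<in>\<Lambda>. c l * cos_basis d l x)"
      unfolding cosine_space_def by blast
    have "{\<tau> \<in> sign_pairs d. signed_sum d l k \<tau> = zero_vector d} =
        {\<tau> \<in> sign_pairs d. int n dvd dot d (signed_sum d l k \<tau>) z}" if "l \<in> \<Lambda>" for l
    proof -
      have "signed_sum d l k \<tau> \<in> A" if "\<tau> \<in> sign_pairs d" for \<tau>
        unfolding A_def sumset_mirror_eq using that \<open>l \<in> \<Lambda>\<close> k by blast
      then show ?thesis
        using adm by (auto simp: admissible_def dot_zero_vector cong_0_iff)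
    qed
    then show "cosine_coeff d f k = tent_lattice_rule d n z (\<lambda>x. f x * cos_basis d k x)"
      unfolding cosine_coeff_expansion[OF f] tent_lattice_rule_expansion[OF assms(1) f]
      by (intro sum.cong refl) simp
  qed
qed

section \<open>Component-by-component construction\<close>

text \<open>
  These are the properties of \<open>\<M>(\<Lambda>) \<oplus> \<M>(\<Lambda>)\<close> that the counting argument uses and that both kinds of
  projection inherit. The empty set is included, since it arises from \<open>\<Lambda> = {}\<close>.
\<close>

definition symmetric_index_set :: "nat \<Rightarrow> (nat \<Rightarrow> int) set \<Rightarrow> bool" where
  "symmetric_index_set s B \<longleftrightarrow> B \<subseteq> {1..s} \<rightarrow>\<^sub>E UNIV \<and> (B \<noteq> {} \<longrightarrow> zero_vector s \<in> B) \<and>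
     (\<forall>h\<in>B. (\<lambda>j\<in>{1..s}. - h j) \<in> B)"

lemma dot_Suc_upd:
  "dot (Suc s) h (z(Suc s := w)) = dot s (restrict h {1..s}) z + h (Suc s) * w"
  by (simp add: dot_def)

lemma dot_uminus: "dot s (\<lambda>j\<in>{1..s}. - h j) z = - dot s h z"
  by (simp add: dot_def sum_negf)

text \<open>
  The vectors with positive \<open>j\<close>-th component, their negatives and the zero vector are disjoint parts
  of \<open>B\<close>.
\<close>

lemma card_positive_component:
  assumes "symmetric_index_set s B" "finite B" "B \<noteq> {}" "j \<in> {1..s}"
  shows "2 * card {h\<in>B. h j > 0} + 1 \<le> card B"
proof -
  let ?neg = "\<lambda>h. \<lambda>j\<in>{1..s}. - h j :: int"
  let ?pos = "{h\<in>B. h j > 0}"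
  have "?neg (?neg h) = h" if "h \<in> ?pos" for h
    using that assms(1) by (auto simp: symmetric_index_set_def PiE_iff extensional_def fun_eq_iff)
  then have inj: "inj_on ?neg ?pos"
    by (rule inj_on_inverseI[where g = ?neg])
  have zero: "zero_vector s \<in> B" "zero_vector s j = 0"
    using assms by (auto simp: symmetric_index_set_def zero_vector_def)
  have "?pos \<inter> ?neg ` ?pos = {}"
    using assms(4) by auto
  then have "2 * card ?pos = card (?pos \<union> ?neg ` ?pos)"
    using assms(2) by (simp add: card_Un_disjoint card_image[OF inj] del: One_nat_def)
  moreover have "zero_vector s \<notin> ?pos \<union> ?neg ` ?pos"
    using assms(4) by (auto simp: zero_vector_def fun_eq_iff restrict_def dest!: spec[of _ j])
  then have "card (?pos \<union> ?neg ` ?pos) + 1 = card (insert (zero_vector s) (?pos \<union> ?neg ` ?pos))"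
    using assms(2) by simp
  moreover have "\<dots> \<le> card B"
    using assms(1,2) zero(1) by (intro card_mono) (auto simp: symmetric_index_set_def)
  ultimately show ?thesis by simp
qed

text \<open>
  If no \<open>w\<close> works, each of the \<open>n - 1\<close> candidates is ruled out by some vector, which may be taken with
  positive last component by passing to its negative. Distinct candidates are ruled out by distinct
  vectors, because the last component is invertible modulo \<open>n\<close>. This requires at least \<open>n - 1\<close> vectors
  with positive last component, which contradicts \<open>card_positive_component\<close> and the bound on \<open>card B\<close>.
\<close>

lemma admissible_extension:
  assumes "prime n" and B: "symmetric_index_set (Suc s) B" "finite B"
    and bound: "\<And>h. h \<in> B \<Longrightarrow> \<bar>h (Suc s)\<bar> < int n"
    and card: "card B + 1 < 2 * n"
    and trunc: "\<And>h. h \<in> B \<Longrightarrow> h (Suc s) = 0 \<Longrightarrow> restrict h {1..s} \<in> B'"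
    and adm: "admissible s n B' z"
  shows "\<exists>w\<in>{1..int n - 1}. admissible (Suc s) n B (z(Suc s := w))"
proof (rule ccontr)
  assume none: "\<not> ?thesis"
  let ?pos = "{h\<in>B. h (Suc s) > 0}"
  have "\<exists>h\<in>?pos. int n dvd dot (Suc s) h (z(Suc s := w))" if w: "w \<in> {1..int n - 1}" for w
  proof -
    obtain h where h: "h \<in> B" "h \<noteq> zero_vector (Suc s)"
      and dvd: "int n dvd dot (Suc s) h (z(Suc s := w))"
      using none w unfolding admissible_def cong_0_iff by blast
    \<comment> \<open>otherwise \<open>h\<close> would violate the admissibility of the components chosen before\<close>
    have "h (Suc s) \<noteq> 0"
    proof
      assume h0: "h (Suc s) = 0"
      have "restrict h {1..s} \<noteq> zero_vector s"
      proof
        assume eq: "restrict h {1..s} = zero_vector s"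
        have "h j = zero_vector (Suc s) j" for j
          using fun_cong[OF eq, of j] h0 h(1) B(1)
          by (cases "j = Suc s") (force simp: zero_vector_def symmetric_index_set_def PiE_iff extensional_def)+
        then show False using h(2) by blast
      qed
      then have "\<not> int n dvd dot s (restrict h {1..s}) z"
        using adm trunc[OF h(1) h0] by (auto simp: admissible_def cong_0_iff)
      then show False
        using dvd h0 by (simp add: dot_Suc_upd)
    qed
    then consider "h (Suc s) > 0" | "h (Suc s) < 0" by linarith
    then show ?thesis
    proof cases
      case 1
      then show ?thesis using h dvd by blast
    next
      case 2
      let ?h = "\<lambda>j\<in>{1..Suc s}. - h j"
      have "?h \<in> ?pos" "int n dvd dot (Suc s) ?h (z(Suc s := w))"
        using 2 h B(1) dvd by (auto simp: symmetric_index_set_def dot_uminus simp del: One_nat_def)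
      then show ?thesis by blast
    qed
  qed
  then obtain g where g: "g w \<in> ?pos" "int n dvd dot (Suc s) (g w) (z(Suc s := w))"
    if "w \<in> {1..int n - 1}" for w
    using bchoice[of "{1..int n - 1}" "\<lambda>w h. h \<in> ?pos \<and> int n dvd dot (Suc s) h (z(Suc s := w))"]
    by blast
  have "inj_on g {1..int n - 1}"
  proof (rule inj_onI)
    fix v w assume vw: "v \<in> {1..int n - 1}" "w \<in> {1..int n - 1}" "g v = g w"
    have "int n dvd dot (Suc s) (g w) (z(Suc s := v)) - dot (Suc s) (g w) (z(Suc s := w))"
      using g(2)[OF vw(1)] g(2)[OF vw(2)] vw(3) by (intro dvd_diff) simp_all
    then have "int n dvd g w (Suc s) * (v - w)"
      by (simp add: dot_Suc_upd algebra_simps)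
    then have "int n dvd g w (Suc s) \<or> int n dvd v - w"
      using \<open>prime n\<close> by (simp add: prime_dvd_mult_iff)
    moreover have "\<not> int n dvd g w (Suc s)"
      using g(1)[OF vw(2)] bound[of "g w"] by (auto dest: zdvd_imp_le)
    moreover have "\<bar>v - w\<bar> < int n"
      using vw(1,2) by auto
    ultimately show "v = w"
      using dvd_imp_le_int[of "v - w" "int n"] by force
  qed
  then have "card {1..int n - 1} \<le> card ?pos"
    using g(1) B(2) by (intro card_inj_on_le[of g]) auto
  moreover have "2 * card ?pos + 1 < 2 * n - 1" if "B \<noteq> {}"
    using card_positive_component[OF B that, of "Suc s"] card by simp
  moreover have "card ?pos = 0" if "B = {}"
    using that by simp
  \<comment> \<open>for empty \<open>B\<close> it suffices that there is a candidate at all\<close>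
  moreover have "n > 1"
    using \<open>prime n\<close> by (rule prime_gt_1_nat)
  ultimately show False
    by (cases "B = {}") auto
qed

text \<open>
  As an image of \<open>A\<close>, the projection has no more elements than \<open>A\<close> and no larger components; zero
  sections share these bounds as subsets of the projections.
\<close>

lemma projection_eq_image:
  assumes "A \<subseteq> {1..d} \<rightarrow>\<^sub>E UNIV" "s \<le> d"
  shows "projection d A s = (\<lambda>a. restrict a {1..s}) ` A"
proof (intro equalityI subsetI)
  fix h assume "h \<in> projection d A s"
  then obtain h' where h: "h \<in> {1..s} \<rightarrow>\<^sub>E UNIV" "(\<lambda>j\<in>{1..d}. if j \<le> s then h j else h' j) \<in> A"
    unfolding projection_def by blast
  moreover have "h = restrict (\<lambda>j\<in>{1..d}. if j \<le> s then h j else h' j) {1..s}"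
    using h(1) assms(2) by (auto simp: fun_eq_iff restrict_def PiE_iff extensional_def)
  ultimately show "h \<in> (\<lambda>a. restrict a {1..s}) ` A" by blast
next
  fix h assume "h \<in> (\<lambda>a. restrict a {1..s}) ` A"
  then obtain a where a: "a \<in> A" "h = restrict a {1..s}" by blast
  moreover have "(\<lambda>j\<in>{1..d}. if j \<le> s then h j else restrict a {s+1..d} j) = a"
    using a assms by (force simp: fun_eq_iff restrict_def PiE_iff extensional_def)
  ultimately show "h \<in> projection d A s"
    unfolding projection_def by (auto intro!: bexI[of _ "restrict a {s+1..d}"])
qed

lemma zero_section_subset_projection: "zero_section d A s \<subseteq> projection d A s"
proof
  fix h assume h: "h \<in> zero_section d A s"
  have "(\<lambda>j\<in>{1..d}. if j \<le> s then h j else 0) =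
      (\<lambda>j\<in>{1..d}. if j \<le> s then h j else (\<lambda>j\<in>{s+1..d}. 0) j)"
    by (auto simp: fun_eq_iff)
  then show "h \<in> projection d A s"
    using h unfolding projection_def zero_section_def
    by (auto intro!: bexI[of _ "\<lambda>j\<in>{s+1..d}. 0"])
qed

lemma symmetric_projection:
  assumes "symmetric_index_set d A" "s \<le> d"
  shows "symmetric_index_set s (projection d A s)"
proof -
  have A: "A \<subseteq> {1..d} \<rightarrow>\<^sub>E UNIV" "A \<noteq> {} \<Longrightarrow> zero_vector d \<in> A"
    "\<And>a. a \<in> A \<Longrightarrow> (\<lambda>j\<in>{1..d}. - a j) \<in> A"
    using assms(1) unfolding symmetric_index_set_def by blast+
  have zero: "zero_vector s = restrict (zero_vector d) {1..s}"
    using assms(2) by (auto simp: zero_vector_def fun_eq_iff)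
  have neg: "(\<lambda>j\<in>{1..s}. - restrict a {1..s} j) = restrict (\<lambda>j\<in>{1..d}. - a j) {1..s}" for a :: "nat \<Rightarrow> int"
    using assms(2) by (auto simp: fun_eq_iff)
  show ?thesis
    unfolding projection_eq_image[OF A(1) assms(2)] symmetric_index_set_def
  proof (intro conjI impI ballI)
    show "(\<lambda>a. restrict a {1..s}) ` A \<subseteq> {1..s} \<rightarrow>\<^sub>E UNIV"
      by auto
    show "zero_vector s \<in> (\<lambda>a. restrict a {1..s}) ` A" if "(\<lambda>a. restrict a {1..s}) ` A \<noteq> {}"
      using A(2) that unfolding zero by blast
    show "(\<lambda>j\<in>{1..s}. - h j) \<in> (\<lambda>a. restrict a {1..s}) ` A" if "h \<in> (\<lambda>a. restrict a {1..s}) ` A" for h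
    proof -
      obtain a where "a \<in> A" "h = restrict a {1..s}" using \<open>h \<in> _\<close> by blast
      then show ?thesis using A(3) neg by blast
    qed
  qed
qed

lemma zero_vector_in_PiE: "zero_vector s \<in> {1..s} \<rightarrow>\<^sub>E UNIV"
  by (simp add: zero_vector_def)

lemma symmetric_zero_section:
  assumes "symmetric_index_set d A"
  shows "symmetric_index_set s (zero_section d A s)"
proof -
  have "(\<lambda>j\<in>{1..d}. if j \<le> s then zero_vector s j else 0) = zero_vector d"
    by (auto simp: zero_vector_def fun_eq_iff)
  moreover have "(\<lambda>j\<in>{1..d}. if j \<le> s then (\<lambda>j\<in>{1..s}. - h j) j else 0) =
      (\<lambda>j\<in>{1..d}. - (\<lambda>j\<in>{1..d}. if j \<le> s then h j else 0) j)" for h :: "nat \<Rightarrow> int"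
    by (auto simp: fun_eq_iff)
  ultimately show ?thesis
    using assms unfolding symmetric_index_set_def zero_section_def
    by (auto simp: zero_vector_in_PiE simp del: restrict_apply One_nat_def)
qed

lemma zero_section_full:
  assumes "A \<subseteq> {1..d} \<rightarrow>\<^sub>E UNIV"
  shows "zero_section d A d = A"
proof -
  have "(\<lambda>j\<in>{1..d}. if j \<le> d then h j else 0) = h" if "h \<in> {1..d} \<rightarrow>\<^sub>E UNIV" for h :: "nat \<Rightarrow> int"
    using that by (auto simp: fun_eq_iff PiE_iff extensional_def)
  then show ?thesis
    using assms unfolding zero_section_def by (auto simp del: restrict_apply)
qed

lemma projection_full:
  assumes "A \<subseteq> {1..d} \<rightarrow>\<^sub>E UNIV"
  shows "projection d A d = A"
proof -
  have "restrict a {1..d} = a" if "a \<in> A" for a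
    using that assms by (auto simp: PiE_iff extensional_restrict)
  then show ?thesis
    by (simp add: projection_eq_image[OF assms])
qed

lemma restrict_in_zero_section:
  assumes "h \<in> zero_section d A (Suc s)" "h (Suc s) = 0"
  shows "restrict h {1..s} \<in> zero_section d A s"
proof -
  have "(\<lambda>j\<in>{1..d}. if j \<le> s then restrict h {1..s} j else 0) =
      (\<lambda>j\<in>{1..d}. if j \<le> Suc s then h j else 0)"
    using assms(2) by (auto simp: fun_eq_iff le_Suc_eq)
  then show ?thesis
    using assms(1) by (simp add: zero_section_def del: restrict_apply One_nat_def)
qed

lemma restrict_in_projection:
  assumes "A \<subseteq> {1..d} \<rightarrow>\<^sub>E UNIV" "s < d" "h \<in> projection d A (Suc s)"
  shows "restrict h {1..s} \<in> projection d A s"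
proof -
  have "restrict (restrict a {1..Suc s}) {1..s} = restrict a {1..s}" for a :: "nat \<Rightarrow> int"
    by (auto simp: fun_eq_iff)
  then show ?thesis
    using assms by (auto simp: projection_eq_image[OF assms(1)] simp del: restrict_apply)
qed

text \<open>
  Zero sections and projections are treated together: \<open>P\<close> may be any family of symmetric subsets of
  the projections for which deleting a vanishing last component leads from \<open>P (Suc s)\<close> to \<open>P s\<close>.
\<close>

lemma cbc_constructibleI:
  assumes "prime n" and A: "symmetric_index_set d A" "finite A"
    and bound: "\<forall>h\<in>A. \<forall>j\<in>{1..d}. \<bar>h j\<bar> < int n"
    and card: "card A + 1 < 2 * n"
    and "P d = A"
    and P: "\<And>s. s \<le> d \<Longrightarrow> symmetric_index_set s (P s)"
      "\<And>s. s \<le> d \<Longrightarrow> P s \<subseteq> projection d A s"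
    and trunc: "\<And>s h. s < d \<Longrightarrow> h \<in> P (Suc s) \<Longrightarrow> h (Suc s) = 0 \<Longrightarrow> restrict h {1..s} \<in> P s"
  shows "cbc_constructible d n A P"
  unfolding cbc_constructible_def
proof (intro conjI ballI impI)
  show "P d = A" by fact
next
  fix s' z assume s': "s' \<in> {1..d}" and adm: "admissible (s' - 1) n (P (s' - 1)) z"
  then obtain s where s: "s' = Suc s" "s < d"
    by (cases s') auto
  have A': "A \<subseteq> {1..d} \<rightarrow>\<^sub>E UNIV"
    using A(1) by (simp add: symmetric_index_set_def)
  have sub: "P (Suc s) \<subseteq> (\<lambda>a. restrict a {1..Suc s}) ` A"
    using P(2)[of "Suc s"] s(2) projection_eq_image[OF A', of "Suc s"] by simp
  have "finite (P (Suc s))"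
    using sub A(2) by (blast intro: finite_subset)
  moreover have "card (P (Suc s)) \<le> card A"
    using card_mono[OF _ sub] card_image_le[OF A(2), of "\<lambda>a. restrict a {1..Suc s}"] A(2) by simp
  moreover have "\<bar>h (Suc s)\<bar> < int n" if "h \<in> P (Suc s)" for h
    using that sub bound s(2) by force
  ultimately have "\<exists>w\<in>{1..int n - 1}. admissible (Suc s) n (P (Suc s)) (z(Suc s := w))"
    using adm s P(1)[of "Suc s"] trunc[OF s(2)] card
    by (intro admissible_extension[OF \<open>prime n\<close>]) auto
  then show "\<exists>w\<in>{1..int n - 1}. admissible s' n (P s') (z(s' := w))"
    by (simp add: s)
qed

lemma cbc_constructible_imp_admissible:
  assumes "cbc_constructible d n A P" and P0: "P 0 \<subseteq> {zero_vector 0}"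
  shows "\<exists>z\<in>{1..d} \<rightarrow>\<^sub>E {1..int n - 1}. admissible d n A z"
proof -
  have "\<exists>z\<in>{1..s} \<rightarrow>\<^sub>E {1..int n - 1}. admissible s n (P s) z" if "s \<le> d" for s
    using that
  proof (induction s)
    case 0
    have "admissible 0 n (P 0) (\<lambda>_. undefined)"
      using P0 by (auto simp: admissible_def)
    then show ?case by auto
  next
    case (Suc s)
    then obtain z where z: "z \<in> {1..s} \<rightarrow>\<^sub>E {1..int n - 1}" "admissible s n (P s) z"
      by auto
    then obtain w where w: "w \<in> {1..int n - 1}" "admissible (Suc s) n (P (Suc s)) (z(Suc s := w))"
      using assms(1) Suc.prems unfolding cbc_constructible_def by (force dest: bspec[of _ _ "Suc s"])
    have "z(Suc s := w) \<in> {1..Suc s} \<rightarrow>\<^sub>E {1..int n - 1}"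
      using z(1) w(1) by (auto simp: PiE_iff extensional_def)
    then show ?case using w(2) by blast
  qed
  then show ?thesis
    using assms(1) unfolding cbc_constructible_def by auto
qed

lemma symmetric_sumset_mirror:
  "symmetric_index_set d (sumset d (mirror d \<Lambda>) (mirror d \<Lambda>))"
  unfolding symmetric_index_set_def
proof (intro conjI impI ballI)
  let ?A = "sumset d (mirror d \<Lambda>) (mirror d \<Lambda>)"
  show "?A \<subseteq> {1..d} \<rightarrow>\<^sub>E UNIV"
    by (auto simp: sumset_def)
  show "zero_vector d \<in> ?A" if "?A \<noteq> {}"
  proof -
    obtain k where "k \<in> \<Lambda>"
      using \<open>?A \<noteq> {}\<close> unfolding sumset_mirror_eq by blast
    moreover have "(\<lambda>j\<in>{1..d}. (1, -1)) \<in> sign_pairs d"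
      by (auto simp: sign_pairs_def)
    moreover have "zero_vector d = signed_sum d k k (\<lambda>j\<in>{1..d}. (1, -1))"
      by (auto simp: signed_sum_def zero_vector_def fun_eq_iff)
    ultimately show ?thesis
      unfolding sumset_mirror_eq by blast
  qed
  show "(\<lambda>j\<in>{1..d}. - h j) \<in> ?A" if "h \<in> ?A" for h
  proof -
    obtain k l \<tau> where kl: "k \<in> \<Lambda>" "l \<in> \<Lambda>" and \<tau>: "\<tau> \<in> sign_pairs d"
      and h: "h = signed_sum d k l \<tau>"
      using \<open>h \<in> ?A\<close> unfolding sumset_mirror_eq by blast
    have "(\<lambda>j\<in>{1..d}. (- fst (\<tau> j), - snd (\<tau> j))) \<in> sign_pairs d"
      using \<tau> by (force simp: sign_pairs_def PiE_iff)
    moreover have "(\<lambda>j\<in>{1..d}. - h j) = signed_sum d k l (\<lambda>j\<in>{1..d}. (- fst (\<tau> j), - snd (\<tau> j)))"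
      by (auto simp: h signed_sum_def fun_eq_iff)
    ultimately show ?thesis
      using kl unfolding sumset_mirror_eq by blast
  qed
qed

lemma finite_sumset_mirror:
  assumes "finite \<Lambda>"
  shows "finite (sumset d (mirror d \<Lambda>) (mirror d \<Lambda>))"
proof -
  have "sumset d (mirror d \<Lambda>) (mirror d \<Lambda>) =
      (\<lambda>(k, l, \<tau>). signed_sum d k l \<tau>) ` (\<Lambda> \<times> \<Lambda> \<times> sign_pairs d)"
    unfolding sumset_mirror_eq by force
  then show ?thesis
    using assms by (simp add: finite_sign_pairs)
qed

lemma le_max_index:
  assumes "finite \<Lambda>" "k \<in> \<Lambda>" "j \<in> {1..d}"
  shows "k j \<le> max_index d \<Lambda>"
proof -
  have "{k j | k j. k \<in> \<Lambda> \<and> j \<in> {1..d}} = (\<lambda>(k, j). k j) ` (\<Lambda> \<times> {1..d})"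
    by force
  then have "finite {k j | k j. k \<in> \<Lambda> \<and> j \<in> {1..d}}"
    using assms(1) by simp
  then show ?thesis
    unfolding max_index_def using assms by (intro Max_ge) auto
qed

lemma abs_sumset_mirror_le:
  assumes "finite \<Lambda>" "h \<in> sumset d (mirror d \<Lambda>) (mirror d \<Lambda>)" "j \<in> {1..d}"
  shows "\<bar>h j\<bar> \<le> 2 * int (max_index d \<Lambda>)"
proof -
  obtain k l \<tau> where kl: "k \<in> \<Lambda>" "l \<in> \<Lambda>" and \<tau>: "\<tau> \<in> sign_pairs d"
    and h: "h = signed_sum d k l \<tau>"
    using assms(2) unfolding sumset_mirror_eq by blast
  have "\<tau> j \<in> {-1, 1} \<times> {-1, 1}"
    using \<tau> assms(3) unfolding sign_pairs_def by (rule PiE_mem)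
  then show ?thesis
    using le_max_index[OF assms(1) kl(1) assms(3)] le_max_index[OF assms(1) kl(2) assms(3)] assms(3)
    by (auto simp: h signed_sum_def)
qed

theorem lemma11:
  fixes d n :: nat and \<Lambda> :: "(nat \<Rightarrow> nat) set"
  assumes "d \<ge> 1" and "n \<ge> 1"
    and "finite \<Lambda>" and "\<Lambda> \<subseteq> {1..d} \<rightarrow>\<^sub>E UNIV"
  defines "A \<equiv> sumset d (mirror d \<Lambda>) (mirror d \<Lambda>)"
  shows "(\<forall>z \<in> {1..d} \<rightarrow>\<^sub>E (UNIV :: int set).
            (\<forall>f \<in> cosine_space d \<Lambda>. \<forall>k\<in>\<Lambda>.
               cosine_coeff d f k = tent_lattice_rule d n z (\<lambda>x. f x * cos_basis d k x))
            \<longleftrightarrow> (\<forall>h \<in> A - {zero_vector d}. \<not> [dot d h z = 0] (mod int n)))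
       \<and> (prime n \<and> real n > max ((real (card A) + 1) / 2) (2 * real (max_index d \<Lambda>)) \<longrightarrow>
            cbc_constructible d n A (zero_section d A) \<and>
            cbc_constructible d n A (projection d A) \<and>
            (\<exists>z \<in> {1..d} \<rightarrow>\<^sub>E {1..int n - 1}.
               \<forall>h \<in> A - {zero_vector d}. \<not> [dot d h z = 0] (mod int n)))"
  unfolding admissible_def[symmetric]
proof (intro conjI ballI impI)
  fix z show "(\<forall>f \<in> cosine_space d \<Lambda>. \<forall>k\<in>\<Lambda>.
      cosine_coeff d f k = tent_lattice_rule d n z (\<lambda>x. f x * cos_basis d k x)) \<longleftrightarrow> admissible d n A z"
    unfolding A_def by (rule reconstruction_iff) fact+
next
  assume n: "prime n \<and> real n > max ((real (card A) + 1) / 2) (2 * real (max_index d \<Lambda>))"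
  have sym: "symmetric_index_set d A" and fin: "finite A"
    unfolding A_def using symmetric_sumset_mirror finite_sumset_mirror[OF assms(3)] by blast+
  have A: "A \<subseteq> {1..d} \<rightarrow>\<^sub>E UNIV"
    using sym by (simp add: symmetric_index_set_def)
  have bound: "\<forall>h\<in>A. \<forall>j\<in>{1..d}. \<bar>h j\<bar> < int n"
  proof (intro ballI)
    fix h j assume "h \<in> A" "j \<in> {1..d}"
    then have "\<bar>h j\<bar> \<le> 2 * int (max_index d \<Lambda>)"
      unfolding A_def by (rule abs_sumset_mirror_le[OF assms(3)])
    then show "\<bar>h j\<bar> < int n" using n by simp
  qed
  have card: "card A + 1 < 2 * n"
    using n by simp
  note cbcI = cbc_constructibleI[OF conjunct1[OF n] sym fin bound card]
  show "cbc_constructible d n A (zero_section d A)"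
  proof (rule cbcI)
    show "restrict h {1..s} \<in> zero_section d A s"
      if "h \<in> zero_section d A (Suc s)" "h (Suc s) = 0" for s h
      using that by (rule restrict_in_zero_section)
  qed (use sym in \<open>simp_all add: zero_section_full[OF A] symmetric_zero_section zero_section_subset_projection\<close>)
  show cbc: "cbc_constructible d n A (projection d A)"
  proof (rule cbcI)
    show "restrict h {1..s} \<in> projection d A s" if "s < d" "h \<in> projection d A (Suc s)" for s h
      using A that by (rule restrict_in_projection)
  qed (use sym in \<open>simp_all add: projection_full[OF A] symmetric_projection\<close>)
  show "\<exists>z \<in> {1..d} \<rightarrow>\<^sub>E {1..int n - 1}. admissible d n A z"
    using cbc by (rule cbc_constructible_imp_admissible) (auto simp: projection_def zero_vector_def)
qed

end
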